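(* Let $N$ be a positive integer and let $\alpha,\beta,\zeta$ be parameters. On the $(N+1)$-dimensional vector space with basis $|0\rangle,\dots,|N\rangle$ consider the operators (with the convention $|N+1\rangle=|-1\rangle=0$) $$Z|n\rangle=(n-\alpha)|n\rangle+|n+1\rangle,\qquad X|n\rangle=-(n-\alpha)^2|n\rangle-(n-\beta)|n+1\rangle,$$ $$V|n\rangle=(n-\beta-\zeta-1)(\beta+\zeta-n)|n\rangle+n(N+1-n)(n-1-2\alpha-\beta-2\zeta+N)|n-1\rangle,$$ and let $\widetilde V=XZ^{-1}$. Then the triplet $(V,\widetilde V,Z)$ is a lower reduced Leonard trio.
   Context: Definition. Let $\mathbb V$ be a finite-dimensional complex vector space and $\mathrm{End}(\mathbb V)$ its space of endomorphisms. A lower reduced Leonard trio is an ordered triplet $(V,\widetilde V,Z)$ of elements of $\mathrm{End}(\mathbb V)$ that satisfies the following properties: (i) there exists a basis of $\mathbb V$ with respect to which the matrix representing $V$ is diagonal, the one representing $\widetilde V Z$ is tridiagonal, and the one representing $Z$ is irreducible tridiagonal; (ii) there exists a basis of $\mathbb V$ with respect to which the matrix representing $\widetilde V$ is diagonal, the one representing $ZV$ is tridiagonal, and the one representing $Z$ is irreducible lower bidiagonal; (iii) there exists a basis of $\mathbb V$ with respect to which the matrix representing $Z$ is diagonal, the one representing $\widetilde V$ is irreducible lower bidiagonal, and the one representing $V$ is irreducible tridiagonal. Matrices of operators follow the convention $Ov_n=\sum_m O_{m,n}v_m$. A tridiagonal matrix is called irreducible when its coefficients on the first upper and first lower diagonals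 are all nonzero; a lower bidiagonal matrix (nonzero entries only on the diagonal and the first lower diagonal) is called irreducible when its coefficients on the first lower diagonal are all nonzero.
   Formalization: The complex parameters are assumed to satisfy α∉{0,…,N}, 2α−β∉{1,…,N}, 2α+β+2ζ∉{N,…,2N−1} and 2(β+ζ)∉{0,…,2N−2}; outside these conditions Z is not invertible or the triplet is not a lower reduced Leonard trio. *)

theory Defs
  imports Complex_Main "Jordan_Normal_Form.Matrix"
begin

definition ordered_basis :: "(complex \<Rightarrow> 'v \<Rightarrow> 'v) \<Rightarrow> 'v::ab_group_add list \<Rightarrow> bool" where
  "ordered_basis scale bs \<longleftrightarrow>
     distinct bs \<and> \<not> module.dependent scale (set bs) \<and> module.span scale (set bs) = UNIV"

text \<open>Column \<open>n\<close> holds the coordinates of the image of the \<open>n\<close>-th basis vector.\<close>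

definition matrix_wrt ::
    "(complex \<Rightarrow> 'v \<Rightarrow> 'v) \<Rightarrow> 'v::ab_group_add list \<Rightarrow> ('v \<Rightarrow> 'v) \<Rightarrow> complex mat" where
  "matrix_wrt scale bs f =
     mat (length bs) (length bs)
       (\<lambda>(m, n). module.representation scale (set bs) (f (bs ! n)) (bs ! m))"

definition tridiagonal :: "'a::zero mat \<Rightarrow> bool" where
  "tridiagonal A \<longleftrightarrow>
     (\<forall>i<dim_row A. \<forall>j<dim_col A. i \<noteq> j \<and> i \<noteq> Suc j \<and> j \<noteq> Suc i \<longrightarrow> A $$ (i, j) = 0)"

definition irreducible_tridiagonal :: "'a::zero mat \<Rightarrow> bool" where
  "irreducible_tridiagonal A \<longleftrightarrow>
     tridiagonal A \<and>
     (\<forall>i. Suc i < dim_row A \<and> i < dim_col A \<longrightarrow> A $$ (Suc i, i) \<noteq> 0) \<and>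
     (\<forall>i. i < dim_row A \<and> Suc i < dim_col A \<longrightarrow> A $$ (i, Suc i) \<noteq> 0)"

definition lower_bidiagonal :: "'a::zero mat \<Rightarrow> bool" where
  "lower_bidiagonal A \<longleftrightarrow>
     (\<forall>i<dim_row A. \<forall>j<dim_col A. i \<noteq> j \<and> i \<noteq> Suc j \<longrightarrow> A $$ (i, j) = 0)"

definition irreducible_lower_bidiagonal :: "'a::zero mat \<Rightarrow> bool" where
  "irreducible_lower_bidiagonal A \<longleftrightarrow>
     lower_bidiagonal A \<and>
     (\<forall>i. Suc i < dim_row A \<and> i < dim_col A \<longrightarrow> A $$ (Suc i, i) \<noteq> 0)"

text \<open>The ambient space is the whole type \<open>'v\<close>. That \<open>scale\<close> makes it a vector space is part of
  linearity, and its finite dimension is part of the existence of a basis given by a list.\<close>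

definition lower_reduced_leonard_trio ::
    "(complex \<Rightarrow> 'v \<Rightarrow> 'v) \<Rightarrow> ('v \<Rightarrow> 'v) \<Rightarrow> ('v \<Rightarrow> 'v) \<Rightarrow> ('v::ab_group_add \<Rightarrow> 'v) \<Rightarrow> bool" where
  "lower_reduced_leonard_trio scale V Vt Z \<longleftrightarrow>
     Vector_Spaces.linear scale scale V \<and>
     Vector_Spaces.linear scale scale Vt \<and>
     Vector_Spaces.linear scale scale Z \<and>
     (\<exists>bs. ordered_basis scale bs \<and>
        diagonal_mat (matrix_wrt scale bs V) \<and>
        tridiagonal (matrix_wrt scale bs (Vt \<circ> Z)) \<and>
        irreducible_tridiagonal (matrix_wrt scale bs Z)) \<and>
     (\<exists>bs. ordered_basis scale bs \<and>
        diagonal_mat (matrix_wrt scale bs Vt) \<and>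
        tridiagonal (matrix_wrt scale bs (Z \<circ> V)) \<and>
        irreducible_lower_bidiagonal (matrix_wrt scale bs Z)) \<and>
     (\<exists>bs. ordered_basis scale bs \<and>
        diagonal_mat (matrix_wrt scale bs Z) \<and>
        irreducible_lower_bidiagonal (matrix_wrt scale bs Vt) \<and>
        irreducible_tridiagonal (matrix_wrt scale bs V))"

end

theory Submission
  imports Defs
begin

text \<open>
  Put \<open>s = \<beta> + \<zeta>\<close>. In the given basis \<open>Z = D + S\<close>, where \<open>D\<close> is diagonal with entries
  \<open>n - \<alpha>\<close> and \<open>S\<close> is the shift \<open>|n\<rangle> \<mapsto> |n + 1\<rangle>\<close>, and \<open>V = q(n) + L\<close> with \<open>L\<close> lowering the
  index by one.

  Properties (iii) and (ii) come from two conjugations. If \<open>T\<close> raises the index by one, then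
  \<open>[D, T] = T\<close>, so conjugation by \<open>exp T\<close> changes \<open>D\<close> by a multiple of \<open>T\<close>. Conjugation by
  \<open>exp S\<close> turns \<open>Z\<close> into \<open>D\<close>, and then \<open>Vt\<close> becomes \<open>- D + T\<close> for another raising operator
  \<open>T\<close>, which a second exponential removes. Under the first conjugation \<open>V\<close> becomes tridiagonal,
  and under the second one \<open>Z V\<close> stays so: up to the weights of \<open>T\<close>, the new coefficients are
  combinations of iterated differences of polynomials in \<open>n\<close>, of degrees so low that all but
  finitely many of them vanish, and the remaining unwanted ones cancel. The bookkeeping for
  both steps is lemma \<open>tri_exp_seq\<close>. The off-diagonal coefficients that have to be nonzero are
  products and quotients of linear factors, which the hypotheses on the parameters keep away
  from zero.

  For (i) no closed form of \<open>Z\<close> and \<open>X = Vt Z\<close> in the eigenbasis of \<open>V\<close> is computed. Instead,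
  with \<open>Y\<close> either of them, \<open>V\<^sup>2 Y - 2 V Y V + Y V\<^sup>2 + 2 (V Y + Y V)\<close> is a polynomial in \<open>V\<close>.
  Read in the eigenbasis this says that the entry \<open>(i, j)\<close> of \<open>Y\<close>, for \<open>i \<noteq> j\<close>, is killed by
  \<open>(q i - q j)\<^sup>2 + 2 (q i + q j)\<close>, which is
  \<open>(i - j - 1) (i - j + 1) (i + j - 2 s) (i + j - 2 - 2 s)\<close>; hence \<open>Y\<close> is tridiagonal (lemma
  \<open>tridiagonal_of_relation\<close>). Irreducibility of \<open>Z\<close> follows from (iii): there \<open>Z\<close> is diagonal
  with distinct eigenvalues and \<open>V\<close> is irreducible tridiagonal, so \<open>V\<close> and \<open>Z\<close> have no common
  invariant subspace besides the trivial ones (lemma \<open>invariant_subspace_eq_UNIV\<close>), whereas a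
  zero next to the diagonal would make some of the eigenvectors of \<open>V\<close> span another one.
\<close>

section \<open>Tridiagonal operators on coefficient sequences\<close>

text \<open>Operators act on untruncated sequences of coefficients, so that no boundary terms at \<open>N\<close> enter the
computations. The functions \<open>l\<close>, \<open>m\<close>, \<open>r\<close> are indexed by the column: the unit sequence at \<open>n\<close> is
mapped to \<open>l n\<close> at \<open>n - 1\<close> plus \<open>m n\<close> at \<open>n\<close> plus \<open>r n\<close> at \<open>n + 1\<close>.\<close>

definition tri ::
    "(nat \<Rightarrow> complex) \<Rightarrow> (nat \<Rightarrow> complex) \<Rightarrow> (nat \<Rightarrow> complex) \<Rightarrow> (nat \<Rightarrow> complex) \<Rightarrow> nat \<Rightarrow> complex" where
  "tri l m r x j =
     l (Suc j) * x (Suc j) + m j * x j + (case j of 0 \<Rightarrow> 0 | Suc i \<Rightarrow> r i * x i)"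

text \<open>The coefficients of \<open>exp T\<close> applied to the unit sequence at \<open>n\<close>, where \<open>T\<close> is the weighted shift
that maps the unit sequence at \<open>k\<close> to \<open>t k\<close> times the one at \<open>k + 1\<close>.\<close>

definition exp_seq :: "(nat \<Rightarrow> complex) \<Rightarrow> nat \<Rightarrow> nat \<Rightarrow> complex" where
  "exp_seq t n j = (if j < n then 0 else (\<Prod>k=n..<j. t k) / fact (j - n))"

lemma exp_seq_less [simp]: "j < n \<Longrightarrow> exp_seq t n j = 0"
  by (simp add: exp_seq_def)

lemma exp_seq_refl [simp]: "exp_seq t n n = 1"
  by (simp add: exp_seq_def)

lemma exp_seq_Suc_right:
  assumes "n \<le> j"
  shows "(of_nat (Suc j) - of_nat n) * exp_seq t n (Suc j) = t j * exp_seq t n j"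
proof -
  have "fact (Suc j - n) = (of_nat (Suc j) - of_nat n :: complex) * fact (j - n)"
    using assms by (simp add: Suc_diff_le of_nat_diff)
  moreover have "(of_nat (Suc j) - of_nat n :: complex) \<noteq> 0"
    using assms by (metis Suc_n_not_le_n eq_iff_diff_eq_0 of_nat_eq_iff)
  ultimately show ?thesis
    using assms by (simp add: exp_seq_def prod.atLeastLessThan_Suc)
qed

lemma exp_seq_Suc_left:
  assumes "n < j"
  shows "t n * exp_seq t (Suc n) j = (of_nat j - of_nat n) * exp_seq t n j"
proof -
  obtain i where j: "j = Suc (n + i)"
    using assms less_imp_Suc_add by blast
  have "(\<Prod>k=n..<j. t k) = t n * (\<Prod>k=Suc n..<j. t k)"
    using assms by (rule prod.atLeast_Suc_lessThan)
  moreover have "fact (j - n) = (of_nat j - of_nat n :: complex) * fact (j - Suc n)"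
    by (simp add: j)
  moreover have "(of_nat j - of_nat n :: complex) \<noteq> 0"
    using assms by simp
  ultimately show ?thesis
    using assms by (simp add: exp_seq_def)
qed

text \<open>Conjugation of a tridiagonal operator by \<open>exp T\<close>. After the weights of \<open>T\<close> are split off, by
\<open>f (n + 1) = t n l (n + 1)\<close> and \<open>r n = \<rho> n t n\<close>, the entry at \<open>j = n + i + 1\<close> of the claim is
\<open>t n \<cdots> t (j - 1) / (i + 2)!\<close> times the last equation before the bounds, in which the weights no
longer occur. For polynomial \<open>f\<close>, \<open>m\<close>, \<open>\<rho>\<close> that equation is a polynomial identity in \<open>n\<close> and \<open>i\<close>.
The splitting is demanded only up to \<open>N\<close>, because weights with denominators satisfy it only where
the denominators are nonzero.\<close>

lemma tri_exp_seq:
  assumes l0: "l 0 = 0" and f0: "f 0 = 0" and f: "\<And>n. n \<le> N \<Longrightarrow> f (Suc n) = t n * l (Suc n)"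
    and r: "\<And>n. n \<le> N \<Longrightarrow> r n = \<rho> n * t n"
    and m': "\<And>n. m' n = m n + f (Suc n) - f n"
    and eq: "\<And>n i. f (n + i + 2) + (of_nat i + 2) * m (n + i + 1)
                 + (of_nat i + 1) * (of_nat i + 2) * \<rho> (n + i)
               = f n + (of_nat i + 2) * m' n + (of_nat i + 1) * (of_nat i + 2) * \<rho>' n"
    and N: "n \<le> N" "j \<le> N"
  shows "tri l m r (exp_seq t n) j
    = l n * exp_seq t (n - 1) j + m' n * exp_seq t n j + \<rho>' n * t n * exp_seq t (Suc n) j"
proof -
  consider "Suc j < n" | "Suc j = n" | "j = n" | i where "j = n + i + 1"
    by (metis Suc_eq_plus1 add_Suc_right less_imp_Suc_add linorder_neqE_nat Suc_lessI)
  then show ?thesis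
  proof cases
    case 1
    then show ?thesis by (simp add: tri_def split: nat.split)
  next
    case 2
    then show ?thesis by (auto simp: tri_def split: nat.split)
  next
    case 3
    have "exp_seq t n (Suc n) = t n"
      using exp_seq_Suc_right[of n n t] by simp
    moreover have "l n * exp_seq t (n - 1) n = f n"
      using N l0 f0 f exp_seq_Suc_right[of "n - 1" "n - 1" t] by (cases n) simp_all
    ultimately show ?thesis
      using 3 N by (simp add: tri_def m' f split: nat.split)
  next
    case 4
    define I where "I = (of_nat i :: complex)"
    have I: "I + 1 \<noteq> 0" "I + 2 \<noteq> 0"
      unfolding I_def by (metis of_nat_1 of_nat_add of_nat_eq_0_iff add_eq_0_iff_both_eq_0 one_neq_zero,
        metis of_nat_numeral of_nat_add of_nat_eq_0_iff add_eq_0_iff_both_eq_0 zero_neq_numeral)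
    define e where "e = exp_seq t n j / (I + 2)"
    \<comment> \<open>\<open>e\<close> is the product of the weights over \<open>(i + 2)!\<close>, the common factor of all terms.\<close>
    have E1: "exp_seq t n j = (I + 2) * e"
      using I by (simp add: e_def)
    have E2: "l (Suc j) * exp_seq t n (Suc j) = f (Suc j) * e"
    proof -
      have "(I + 2) * exp_seq t n (Suc j) = t j * ((I + 2) * e)"
        using exp_seq_Suc_right[of n j t] 4 unfolding E1[symmetric] by (simp add: I_def algebra_simps)
      then have "exp_seq t n (Suc j) = t j * e"
        using I by simp
      then show ?thesis using N by (simp add: f)
    qed
    have E0: "r (n + i) * exp_seq t n (n + i) = \<rho> (n + i) * ((I + 1) * (I + 2) * e)"
    proof -
      have "(I + 1) * exp_seq t n j = t (n + i) * exp_seq t n (n + i)"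
        using exp_seq_Suc_right[of n "n + i" t] 4 by (simp add: I_def algebra_simps)
      moreover have "r (n + i) = \<rho> (n + i) * t (n + i)"
        using 4 N by (intro r) simp
      ultimately show ?thesis by (simp add: E1 mult.assoc mult.left_commute)
    qed
    have E3: "t n * exp_seq t (Suc n) j = (I + 1) * (I + 2) * e"
    proof -
      have "t n * exp_seq t (Suc n) j = (I + 1) * exp_seq t n j"
        using exp_seq_Suc_left[of n j t] 4 by (simp add: I_def algebra_simps)
      then show ?thesis by (simp add: E1 mult.assoc)
    qed
    have E4: "l n * exp_seq t (n - 1) j = f n * e"
    proof (cases n)
      case (Suc k)
      have "t k * exp_seq t n j = (I + 2) * exp_seq t k j"
        using exp_seq_Suc_left[of k j t] 4 Suc by (simp add: I_def algebra_simps)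
      then have "exp_seq t k j = t k * e"
        using I by (simp add: E1)
      then show ?thesis using Suc N by (simp add: f)
    qed (simp add: l0 f0)
    have "tri l m r (exp_seq t n) j
        = f (n + i + 2) * e + m (n + i + 1) * ((I + 2) * e) + \<rho> (n + i) * ((I + 1) * (I + 2) * e)"
      using 4 E2 E1 E0 by (simp add: tri_def)
    also have "\<dots> = (f (n + i + 2) + (I + 2) * m (n + i + 1) + (I + 1) * (I + 2) * \<rho> (n + i)) * e"
      by (simp add: algebra_simps)
    also have "\<dots> = (f n + (I + 2) * m' n + (I + 1) * (I + 2) * \<rho>' n) * e"
      using eq[of n i] by (simp add: I_def)
    also have "\<dots> = l n * exp_seq t (n - 1) j + m' n * exp_seq t n j
        + \<rho>' n * (t n * exp_seq t (Suc n) j)"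
      by (simp only: E1 E3 E4) (simp add: algebra_simps)
    finally show ?thesis by (simp add: mult.assoc)
  qed
qed

text \<open>The eigenvector for \<open>q k\<close> of the upper bidiagonal operator with diagonal \<open>q\<close>, normalised to have
leading coefficient \<open>1\<close> at \<open>k\<close>.\<close>

definition eig_seq :: "(nat \<Rightarrow> complex) \<Rightarrow> (nat \<Rightarrow> complex) \<Rightarrow> nat \<Rightarrow> nat \<Rightarrow> complex" where
  "eig_seq l q k j = (if j \<le> k then \<Prod>i=j..<k. l (Suc i) / (q k - q i) else 0)"

lemma tri_eig_seq:
  assumes "\<And>i. i < k \<Longrightarrow> q i \<noteq> q k"
  shows "tri l q (\<lambda>_. 0) (eig_seq l q k) j = q k * eig_seq l q k j"
proof -
  consider "j < k" | "j = k" | "k < j" by linarith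
  then show ?thesis
  proof cases
    case 1
    have "(\<Prod>i=j..<k. l (Suc i) / (q k - q i))
        = l (Suc j) / (q k - q j) * (\<Prod>i=Suc j..<k. l (Suc i) / (q k - q i))"
      using 1 by (rule prod.atLeast_Suc_lessThan)
    then have "l (Suc j) * eig_seq l q k (Suc j) = (q k - q j) * eig_seq l q k j"
      using 1 assms[of j] by (simp add: eig_seq_def)
    then show ?thesis by (simp add: tri_def algebra_simps split: nat.split)
  qed (auto simp: tri_def eig_seq_def split: nat.split)
qed

section \<open>Bases indexed by an initial segment\<close>

locale complex_vector_space = vector_space scale
  for scale :: "complex \<Rightarrow> 'v::ab_group_add \<Rightarrow> 'v" (infixr "*s" 75)
begin

definition comb :: "nat \<Rightarrow> (nat \<Rightarrow> 'v) \<Rightarrow> (nat \<Rightarrow> complex) \<Rightarrow> 'v" where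
  "comb N u x = (\<Sum>j\<le>N. x j *s u j)"

abbreviation is_basis :: "nat \<Rightarrow> (nat \<Rightarrow> 'v) \<Rightarrow> bool" where
  "is_basis N u \<equiv> ordered_basis scale (map u [0..<Suc N])"

lemma comb_cong: "(\<And>j. j \<le> N \<Longrightarrow> x j = y j) \<Longrightarrow> comb N u x = comb N u y"
  by (simp add: comb_def)

lemma comb_add: "comb N u x + comb N u y = comb N u (\<lambda>j. x j + y j)"
  by (simp add: comb_def sum.distrib scale_left_distrib)

lemma comb_diff: "comb N u x - comb N u y = comb N u (\<lambda>j. x j - y j)"
  by (simp add: comb_def sum_subtractf scale_left_diff_distrib)

lemma scale_comb: "c *s comb N u x = comb N u (\<lambda>j. c * x j)"
  by (simp add: comb_def scale_sum_right)

lemma comb_single: "k \<le> N \<Longrightarrow> comb N u (\<lambda>j. if j = k then c else 0) = c *s u k"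
proof -
  assume "k \<le> N"
  have "comb N u (\<lambda>j. if j = k then c else 0) = (\<Sum>j\<le>N. if j = k then c *s u k else 0)"
    unfolding comb_def by (rule sum.cong) auto
  then show ?thesis using \<open>k \<le> N\<close> by simp
qed

lemma set_basis_list: "set (map u [0..<Suc N]) = u ` {..N}"
  by (simp only: set_map set_upt atLeast0LessThan lessThan_Suc_atMost)

lemma is_basis_iff:
  "is_basis N u \<longleftrightarrow> inj_on u {..N} \<and> independent (u ` {..N}) \<and> span (u ` {..N}) = UNIV"
  unfolding ordered_basis_def set_basis_list
  by (simp only: distinct_map distinct_upt set_upt atLeast0LessThan lessThan_Suc_atMost simp_thms)

lemma representation_comb:
  assumes "is_basis N u" and "j \<le> N"
  shows "representation (u ` {..N}) (comb N u x) (u j) = x j"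
proof -
  have b: "inj_on u {..N}" "independent (u ` {..N})" "span (u ` {..N}) = UNIV"
    using assms(1) unfolding is_basis_iff by auto
  have "representation (u ` {..N}) (comb N u x) (u j)
      = (\<Sum>i\<le>N. x i * representation (u ` {..N}) (u i) (u j))"
    unfolding comb_def using b by (simp add: representation_sum representation_scale)
  also have "\<dots> = (\<Sum>i\<le>N. if i = j then x j else 0)"
    using b assms(2) by (intro sum.cong) (auto simp: representation_basis dest: inj_onD)
  finally show ?thesis using assms(2) by simp
qed

lemma comb_eq_0D: "is_basis N u \<Longrightarrow> comb N u x = 0 \<Longrightarrow> j \<le> N \<Longrightarrow> x j = 0"
  using representation_comb[of u N j x] by (simp add: representation_zero)

lemma is_basis_nonzero: "is_basis N u \<Longrightarrow> j \<le> N \<Longrightarrow> u j \<noteq> 0"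
  using comb_eq_0D[of u N "\<lambda>i. if i = j then 1 else 0" j] comb_single[of j N u 1] by auto

lemma comb_surj:
  assumes "is_basis N u"
  obtains c where "x = comb N u c"
proof -
  have b: "inj_on u {..N}" "x \<in> span (u ` {..N})"
    using assms unfolding is_basis_iff by auto
  then obtain g where "x = (\<Sum>v\<in>u ` {..N}. g v *s v)"
    by (auto simp: span_finite)
  then have "x = comb N u (g \<circ> u)"
    using b by (simp add: comb_def sum.reindex)
  then show thesis using that by blast
qed

lemma matrix_wrt_comb:
  assumes "is_basis N u" and "\<And>n. n \<le> N \<Longrightarrow> A (u n) = comb N u (c n)"
  shows "matrix_wrt scale (map u [0..<Suc N]) A = mat (Suc N) (Suc N) (\<lambda>(i, j). c j i)"
proof (rule eq_matI)
  fix i j assume "i < dim_row (mat (Suc N) (Suc N) (\<lambda>(i, j). c j i))"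
    and "j < dim_col (mat (Suc N) (Suc N) (\<lambda>(i, j). c j i))"
  then have ij: "i \<le> N" "j \<le> N" by auto
  then show "matrix_wrt scale (map u [0..<Suc N]) A $$ (i, j)
      = mat (Suc N) (Suc N) (\<lambda>(i, j). c j i) $$ (i, j)"
    unfolding matrix_wrt_def set_basis_list
    using assms by (simp add: representation_comb nth_append del: upt_Suc)
qed (simp_all add: matrix_wrt_def)

text \<open>By the exchange lemma every spanning set has at least \<open>N + 1\<close> elements; so no \<open>v n\<close> is redundant
and no two of them coincide.\<close>

lemma is_basis_if_spanning:
  assumes "is_basis N u" and "span (v ` {..N}) = UNIV"
  shows "is_basis N v"
proof -
  have u: "card (u ` {..N}) = Suc N" "independent (u ` {..N})"
    using assms(1) unfolding is_basis_iff by (auto simp: card_image)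
  have bound: "Suc N \<le> card T" if "finite T" "span T = UNIV" for T
    using independent_span_bound[OF that(1) u(2)] u(1) that(2) by simp
  have card: "card (v ` {..N}) = Suc N"
    using bound[OF _ assms(2)] card_image_le[of "{..N}" v] by simp
  have "independent (v ` {..N})"
  proof
    assume "dependent (v ` {..N})"
    then obtain a where a: "a \<in> v ` {..N}" "a \<in> span (v ` {..N} - {a})"
      by (auto simp: dependent_def)
    then have "span (v ` {..N} - {a}) = UNIV"
      using span_redundant assms(2) insert_Diff by metis
    then show False
      using bound[of "v ` {..N} - {a}"] card a(1) by simp
  qed
  moreover have "inj_on v {..N}"
    using card by (intro eq_card_imp_inj_on) simp_all
  ultimately show ?thesis
    using assms(2) is_basis_iff by blast
qed

text \<open>Triangularity is measured by an arbitrary key, so that one statement covers the lower triangular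
change of basis given by exponentials and the upper triangular one given by the eigenvectors of \<open>V\<close>.\<close>

lemma is_basis_unitriangular:
  fixes key :: "nat \<Rightarrow> nat"
  assumes "is_basis N u"
    and "\<And>n. n \<le> N \<Longrightarrow> E n n = 1"
    and "\<And>n j. n \<le> N \<Longrightarrow> j \<le> N \<Longrightarrow> j \<noteq> n \<Longrightarrow> E n j \<noteq> 0 \<Longrightarrow> key j < key n"
  shows "is_basis N (\<lambda>n. comb N u (E n))" (is "is_basis N ?v")
proof (rule is_basis_if_spanning[OF assms(1)])
  have in_span: "n \<le> N \<longrightarrow> u n \<in> span (?v ` {..N})" for n
  proof (induction n rule: measure_induct_rule[of key])
    case (less n)
    show ?case
    proof
      assume n: "n \<le> N"
      have "?v n = u n + (\<Sum>j\<in>{..N} - {n}. E n j *s u j)"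
        using n assms(2) by (simp add: comb_def sum.remove)
      then have "u n = ?v n - (\<Sum>j\<in>{..N} - {n}. E n j *s u j)"
        by simp
      also have "\<dots> \<in> span (?v ` {..N})"
      proof (intro span_diff span_sum)
        fix j assume "j \<in> {..N} - {n}"
        then show "E n j *s u j \<in> span (?v ` {..N})"
          using less.IH[of j] assms(3)[of n j] n
          by (cases "E n j = 0") (auto intro: span_scale span_zero)
      qed (use n in \<open>auto intro: span_base\<close>)
      finally show "u n \<in> span (?v ` {..N})" .
    qed
  qed
  have "span (u ` {..N}) \<subseteq> span (?v ` {..N})"
    by (rule span_minimal) (use in_span in auto)
  then show "span (?v ` {..N}) = UNIV"
    using assms(1) unfolding is_basis_iff by auto
qed

section \<open>Operators with a banded action on a basis\<close>

text \<open>The boundary conditions make the formula meaningful at both ends: \<open>u (0 - 1)\<close> is \<open>u 0\<close> and is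
multiplied by \<open>0\<close>, the vector \<open>u (Suc N)\<close> is \<open>0\<close>, and \<open>l (Suc N) = 0\<close> makes the truncation of
sequences at \<open>N\<close> compatible with the untruncated operator \<open>tri l m r\<close>.\<close>

definition band_action ::
    "nat \<Rightarrow> (nat \<Rightarrow> 'v) \<Rightarrow> ('v \<Rightarrow> 'v) \<Rightarrow> (nat \<Rightarrow> complex) \<Rightarrow> (nat \<Rightarrow> complex) \<Rightarrow> (nat \<Rightarrow> complex) \<Rightarrow> bool"
  where
  "band_action N u A l m r \<longleftrightarrow>
     Vector_Spaces.linear scale scale A \<and> l 0 = 0 \<and> l (Suc N) = 0 \<and> u (Suc N) = 0 \<and>
     (\<forall>n\<le>N. A (u n) = l n *s u (n - 1) + m n *s u n + r n *s u (Suc n))"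

lemma band_action_comb:
  assumes "band_action N u A l m r"
  shows "A (comb N u x) = comb N u (tri l m r x)"
proof -
  have *: "Vector_Spaces.linear scale scale A" "l 0 = 0" "l (Suc N) = 0" "u (Suc N) = 0"
    and A: "\<And>n. n \<le> N \<Longrightarrow> A (u n) = l n *s u (n - 1) + m n *s u n + r n *s u (Suc n)"
    using assms unfolding band_action_def by auto
  interpret A: Vector_Spaces.linear scale scale A by fact
  \<comment> \<open>Both index shifts lose or gain only a boundary term, which vanishes.\<close>
  have low: "(\<Sum>j\<le>N. (x j * l j) *s u (j - 1)) = (\<Sum>j\<le>N. (l (Suc j) * x (Suc j)) *s u j)"
    using sum.atMost_Suc[of "\<lambda>j. (x j * l j) *s u (j - 1)" N]
      sum.atMost_Suc_shift[of "\<lambda>j. (x j * l j) *s u (j - 1)" N] *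
    by (simp add: mult.commute)
  define h where "h j = (case j of 0 \<Rightarrow> 0 | Suc i \<Rightarrow> r i * x i) *s u j" for j
  have high: "(\<Sum>j\<le>N. (x j * r j) *s u (Suc j)) = (\<Sum>j\<le>N. h j)"
    using sum.atMost_Suc[of h N] sum.atMost_Suc_shift[of h N] *
    by (simp add: h_def mult.commute)
  have "A (comb N u x) = (\<Sum>j\<le>N. x j *s A (u j))"
    by (simp add: comb_def A.sum A.scale)
  also have "\<dots> = (\<Sum>j\<le>N. (x j * l j) *s u (j - 1)) + (\<Sum>j\<le>N. (m j * x j) *s u j)
      + (\<Sum>j\<le>N. (x j * r j) *s u (Suc j))"
    by (simp add: A scale_right_distrib sum.distrib mult.commute)
  also have "\<dots> = comb N u (tri l m r x)"
    unfolding low high by (simp add: comb_def tri_def h_def scale_left_distrib sum.distrib)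
  finally show ?thesis .
qed

lemma matrix_wrt_band_action:
  assumes "is_basis N u" and "band_action N u A l m r"
  shows "matrix_wrt scale (map u [0..<Suc N]) A = mat (Suc N) (Suc N)
    (\<lambda>(i, j). if i = j then m j else if i = Suc j then r j else if j = Suc i then l j else 0)"
proof -
  let ?c = "\<lambda>n i. if i = n then m n else if i = Suc n then r n else if n = Suc i then l n else 0"
  have cols: "A (u n) = comb N u (?c n)" if "n \<le> N" for n
  proof -
    have "A (u n) = comb N u (tri l m r (\<lambda>j. if j = n then 1 else 0))"
      using band_action_comb[OF assms(2), of "\<lambda>j. if j = n then 1 else 0"] comb_single[OF that]
      by simp
    also have "\<dots> = comb N u (?c n)"
      by (rule comb_cong) (auto simp: tri_def split: nat.split)
    finally show ?thesis .
  qed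
  have "mat (Suc N) (Suc N) (\<lambda>(i, j). ?c j i) = mat (Suc N) (Suc N)
    (\<lambda>(i, j). if i = j then m j else if i = Suc j then r j else if j = Suc i then l j else 0)"
    by (rule eq_matI) auto
  with matrix_wrt_comb[where A = A and c = ?c, OF assms(1) cols] show ?thesis
    by (rule trans)
qed

lemma band_action_exp_seq:
  assumes A: "band_action N u A l m r"
    and "f 0 = 0" and "\<And>n. n \<le> N \<Longrightarrow> f (Suc n) = t n * l (Suc n)"
    and "\<And>n. n \<le> N \<Longrightarrow> r n = \<rho> n * t n"
    and "\<And>n. m' n = m n + f (Suc n) - f n"
    and "\<And>n i. f (n + i + 2) + (of_nat i + 2) * m (n + i + 1)
                 + (of_nat i + 1) * (of_nat i + 2) * \<rho> (n + i)
               = f n + (of_nat i + 2) * m' n + (of_nat i + 1) * (of_nat i + 2) * \<rho>' n"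
  shows "band_action N (\<lambda>n. comb N u (exp_seq t n)) A l m' (\<lambda>n. \<rho>' n * t n)"
proof -
  have l: "l 0 = 0" "l (Suc N) = 0" and lin: "Vector_Spaces.linear scale scale A"
    using A unfolding band_action_def by auto
  have "comb N u (exp_seq t (Suc N)) = 0"
    by (simp add: comb_def)
  moreover have "A (comb N u (exp_seq t n)) = l n *s comb N u (exp_seq t (n - 1))
      + m' n *s comb N u (exp_seq t n) + (\<rho>' n * t n) *s comb N u (exp_seq t (Suc n))" if "n \<le> N" for n
    unfolding band_action_comb[OF A] scale_comb comb_add
    by (intro comb_cong) (rule tri_exp_seq[OF l(1) assms(2-) that])
  ultimately show ?thesis
    using l lin by (simp add: band_action_def)
qed

lemma is_basis_exp_seq:
  assumes "is_basis N u"
  shows "is_basis N (\<lambda>n. comb N u (exp_seq t n))"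
proof (rule is_basis_unitriangular[OF assms, where key = "\<lambda>n. N - n"])
  fix n j assume "n \<le> N" "j \<le> N" "j \<noteq> n" "exp_seq t n j \<noteq> 0"
  then show "N - j < N - n"
    by (cases "j < n") auto
qed simp

section \<open>Tridiagonality and irreducibility in an eigenbasis\<close>

text \<open>In the eigenbasis of \<open>V\<close> the entry \<open>(i, j)\<close> of the left-hand side of the relation is the entry of \<open>Y\<close>
times \<open>(\<theta> i - \<theta> j)\<^sup>2 + 2 (\<theta> i + \<theta> j)\<close>, while the right-hand side is diagonal.\<close>

lemma tridiagonal_of_relation:
  assumes h: "is_basis N h"
    and V: "Vector_Spaces.linear scale scale V" and Y: "Vector_Spaces.linear scale scale Y"
    and eig: "\<And>k. k \<le> N \<Longrightarrow> V (h k) = \<theta> k *s h k"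
    and rel: "\<And>x. V (V (Y x)) - 2 *s V (Y (V x)) + Y (V (V x)) + 2 *s (V (Y x) + Y (V x))
                = g0 *s x + g1 *s V x + g2 *s V (V x)"
    and nondeg: "\<And>i j. i \<le> N \<Longrightarrow> j \<le> N \<Longrightarrow> i \<noteq> j \<Longrightarrow> i \<noteq> Suc j \<Longrightarrow> j \<noteq> Suc i \<Longrightarrow>
                (\<theta> i - \<theta> j)\<^sup>2 + 2 * (\<theta> i + \<theta> j) \<noteq> 0"
  shows "tridiagonal (matrix_wrt scale (map h [0..<Suc N]) Y)"
proof -
  interpret V: Vector_Spaces.linear scale scale V by fact
  interpret Y: Vector_Spaces.linear scale scale Y by fact
  have "\<forall>k. \<exists>c. Y (h k) = comb N h c"
    using comb_surj[OF h] by metis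
  then obtain c where c: "\<And>k. Y (h k) = comb N h (c k)" by metis
  have Vc: "V (comb N h x) = comb N h (\<lambda>j. \<theta> j * x j)" for x
    unfolding comb_def by (simp add: V.sum V.scale eig mult.commute)
  have "c j i = 0" if ij: "i \<le> N" "j \<le> N" "i \<noteq> j" "i \<noteq> Suc j" "j \<noteq> Suc i" for i j
  proof -
    let ?\<gamma> = "g0 + g1 * \<theta> j + g2 * \<theta> j * \<theta> j"
    have Yj: "Y (\<theta> j *s h j) = \<theta> j *s comb N h (c j)"
      by (simp add: Y.scale c)
    have "comb N h (\<lambda>i. if i = j then ?\<gamma> else 0) = ?\<gamma> *s h j"
      using ij(2) by (rule comb_single)
    also have "\<dots> = V (V (Y (h j))) - 2 *s V (Y (V (h j))) + Y (V (V (h j)))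
        + 2 *s (V (Y (h j)) + Y (V (h j)))"
      unfolding rel using ij(2) by (simp add: eig V.scale scale_left_distrib mult.assoc)
    also have "\<dots> = comb N h (\<lambda>i. \<theta> i * (\<theta> i * c j i) - 2 * (\<theta> i * (\<theta> j * c j i))
        + \<theta> j * (\<theta> j * c j i) + 2 * (\<theta> i * c j i + \<theta> j * c j i))"
      using ij(2) by (simp only: eig V.scale Y.scale c Vc scale_comb comb_add comb_diff)
    finally have "comb N h (\<lambda>i. \<theta> i * (\<theta> i * c j i) - 2 * (\<theta> i * (\<theta> j * c j i))
        + \<theta> j * (\<theta> j * c j i) + 2 * (\<theta> i * c j i + \<theta> j * c j i)
        - (if i = j then ?\<gamma> else 0)) = 0"
      by (simp flip: comb_diff)
    from comb_eq_0D[OF h this ij(1)]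
    have "((\<theta> i - \<theta> j)\<^sup>2 + 2 * (\<theta> i + \<theta> j)) * c j i = 0"
      using ij(3) by (simp add: power2_eq_square algebra_simps)
    then show ?thesis
      using nondeg[OF ij] by simp
  qed
  then show ?thesis
    unfolding matrix_wrt_comb[where A = Y and c = c, OF h c] tridiagonal_def by simp
qed

text \<open>A nonzero invariant subspace contains an eigenvector of \<open>Z\<close>, since polynomials in \<open>Z\<close> isolate the
components of a vector. Applying \<open>V\<close> to it brings in its two neighbours, which \<open>Z\<close> again separates;
so the subspace contains all eigenvectors of \<open>Z\<close>.\<close>

lemma invariant_subspace_eq_UNIV:
  assumes u: "is_basis N u"
    and Z: "band_action N u Z (\<lambda>_. 0) a (\<lambda>_. 0)" and a: "inj a"
    and V: "band_action N u V l b r"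
    and l: "\<And>n. n < N \<Longrightarrow> l (Suc n) \<noteq> 0" and r: "\<And>n. n < N \<Longrightarrow> r n \<noteq> 0"
    and W: "subspace W" and ZW: "\<And>x. x \<in> W \<Longrightarrow> Z x \<in> W" and VW: "\<And>x. x \<in> W \<Longrightarrow> V x \<in> W"
    and x: "x \<in> W" "x \<noteq> 0"
  shows "W = UNIV"
proof -
  have Zc: "Z (comb N u c) = comb N u (\<lambda>j. a j * c j)" for c
    unfolding band_action_comb[OF Z] by (rule comb_cong) (simp add: tri_def split: nat.split)
  have cancel: "y \<in> W" if "c *s y \<in> W" "c \<noteq> 0" for c y
    using subspace_scale[OF W that(1), of "inverse c"] that(2) by simp
  have ex: "\<exists>n\<le>N. u n \<in> W" if "comb N u c \<in> W" "comb N u c \<noteq> 0" for c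
    using that
  proof (induction c rule: measure_induct_rule[of "\<lambda>c. card {j. j \<le> N \<and> c j \<noteq> 0}"])
    case (less c)
    obtain k where k: "k \<le> N" "c k \<noteq> 0"
      using less.prems(2) by (force simp: comb_def intro: sum.neutral)
    show ?case
    proof (cases "\<exists>i\<le>N. i \<noteq> k \<and> c i \<noteq> 0")
      case True
      then obtain i where i: "i \<le> N" "i \<noteq> k" "c i \<noteq> 0" by blast
      \<comment> \<open>\<open>Z - a i\<close> removes the component at \<open>i\<close> and keeps the one at \<open>k\<close>.\<close>
      define c' where "c' j = (a j - a i) * c j" for j
      have "comb N u c' = Z (comb N u c) - a i *s comb N u c"
        unfolding Zc scale_comb comb_diff c'_def by (simp add: algebra_simps)
      then have "comb N u c' \<in> W"
        using less.prems(1) W ZW by (simp add: subspace_diff subspace_scale)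
      moreover have "comb N u c' \<noteq> 0"
        using comb_eq_0D[OF u, of c' k] k i(2) injD[OF a, of k i] by (auto simp: c'_def)
      moreover have "{j. j \<le> N \<and> c' j \<noteq> 0} \<subset> {j. j \<le> N \<and> c j \<noteq> 0}"
        using i by (auto simp: c'_def)
      then have "card {j. j \<le> N \<and> c' j \<noteq> 0} < card {j. j \<le> N \<and> c j \<noteq> 0}"
        by (rule psubset_card_mono[rotated]) simp
      ultimately show ?thesis using less.IH by blast
    next
      case False
      then have "comb N u c = comb N u (\<lambda>j. if j = k then c k else 0)"
        by (intro comb_cong) auto
      then have "c k *s u k \<in> W"
        using less.prems(1) comb_single[OF k(1)] by simp
      then show ?thesis using cancel k by blast
    qed
  qed
  obtain c where "x = comb N u c" using comb_surj[OF u] by blast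
  with ex x obtain n where n: "n \<le> N" "u n \<in> W" by blast
  interpret Z: Vector_Spaces.linear scale scale Z using Z unfolding band_action_def by simp
  have Zu: "Z (u i) = a i *s u i" if "i \<le> Suc N" for i
    using Z that unfolding band_action_def by (cases "i = Suc N") (auto simp: Z.zero)
  \<comment> \<open>\<open>Z - e\<close> applied to \<open>(V - b i) (u i)\<close>; taking for \<open>e\<close> the eigenvalue of one neighbour
    removes it.\<close>
  have step: "(l i * (a (i - 1) - e)) *s u (i - 1) + (r i * (a (Suc i) - e)) *s u (Suc i) \<in> W"
    if "i \<le> N" "u i \<in> W" for i e
  proof -
    let ?y = "l i *s u (i - 1) + r i *s u (Suc i)"
    have "?y = V (u i) - b i *s u i"
      using V that(1) unfolding band_action_def by (simp add: algebra_simps)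
    then have y: "?y \<in> W"
      using that W VW by (simp add: subspace_diff subspace_scale)
    have "Z ?y - e *s ?y \<in> W"
      using y W ZW by (intro subspace_diff subspace_scale) auto
    moreover have "Z ?y - e *s ?y
        = (l i * (a (i - 1) - e)) *s u (i - 1) + (r i * (a (Suc i) - e)) *s u (Suc i)"
      using that(1) by (simp add: Z.add Z.scale Zu algebra_simps)
    ultimately show ?thesis by simp
  qed
  have up: "u (Suc i) \<in> W" if "i < N" "u i \<in> W" for i
  proof -
    have "l i * (a (i - 1) - a (i - 1)) = 0" by simp
    then have "(r i * (a (Suc i) - a (i - 1))) *s u (Suc i) \<in> W"
      using step[of i "a (i - 1)"] that by simp
    moreover have "r i * (a (Suc i) - a (i - 1)) \<noteq> 0"
      using r[OF that(1)] injD[OF a, of "Suc i" "i - 1"] by auto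
    ultimately show ?thesis using cancel by blast
  qed
  have down: "u i \<in> W" if "i < N" "u (Suc i) \<in> W" for i
  proof -
    have "(l (Suc i) * (a i - a (Suc (Suc i)))) *s u i \<in> W"
      using step[of "Suc i" "a (Suc (Suc i))"] that by simp
    moreover have "l (Suc i) * (a i - a (Suc (Suc i))) \<noteq> 0"
      using l[OF that(1)] injD[OF a, of i "Suc (Suc i)"] by auto
    ultimately show ?thesis using cancel by blast
  qed
  have 0: "u 0 \<in> W"
    using n by (induction n) (use down in \<open>auto simp: Suc_le_eq\<close>)
  have all: "i \<le> N \<longrightarrow> u i \<in> W" for i
    by (induction i) (auto intro: 0 up)
  have "span (u ` {..N}) \<subseteq> W"
    by (rule span_minimal) (use all W in auto)
  then show ?thesis
    using u unfolding is_basis_iff by auto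
qed

text \<open>If an entry next to the diagonal of a tridiagonal matrix is zero, then the basis vectors up to that
place, or those beyond it, span an invariant subspace.\<close>

lemma irreducible_tridiagonal_of_no_invariant:
  assumes h: "is_basis N h"
    and V: "Vector_Spaces.linear scale scale V" and Y: "Vector_Spaces.linear scale scale Y"
    and eig: "\<And>k. k \<le> N \<Longrightarrow> V (h k) = \<theta> k *s h k"
    and tri: "tridiagonal (matrix_wrt scale (map h [0..<Suc N]) Y)"
    and irr: "\<And>W x. subspace W \<Longrightarrow> (\<And>x. x \<in> W \<Longrightarrow> Y x \<in> W) \<Longrightarrow> (\<And>x. x \<in> W \<Longrightarrow> V x \<in> W) \<Longrightarrow>
                x \<in> W \<Longrightarrow> x \<noteq> 0 \<Longrightarrow> W = UNIV"
  shows "irreducible_tridiagonal (matrix_wrt scale (map h [0..<Suc N]) Y)"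
proof -
  interpret V: Vector_Spaces.linear scale scale V by fact
  interpret Y: Vector_Spaces.linear scale scale Y by fact
  have "\<forall>k. \<exists>c. Y (h k) = comb N h c"
    using comb_surj[OF h] by metis
  then obtain c where c: "\<And>k. Y (h k) = comb N h (c k)" by metis
  note M = matrix_wrt_comb[where A = Y and c = c, OF h c]
  have c0: "c j i = 0" if "i \<le> N" "j \<le> N" "i \<noteq> j" "i \<noteq> Suc j" "j \<noteq> Suc i" for i j
    using tri that unfolding M tridiagonal_def by simp
  have no_block: False
    if J: "J \<subseteq> {..N}" "k \<in> J" "k' \<le> N" "k' \<notin> J"
      and block: "\<And>j i. j \<in> J \<Longrightarrow> i \<le> N \<Longrightarrow> i \<notin> J \<Longrightarrow> c j i = 0" for J k k'
  proof -
    let ?W = "span (h ` J)"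
    have Yh: "Y (h j) \<in> ?W" if "j \<in> J" for j
      unfolding c comb_def
    proof (rule span_sum)
      fix i assume "i \<in> {..N}"
      then show "c j i *s h i \<in> ?W"
        using block[OF that, of i] by (cases "i \<in> J") (auto intro: span_scale span_base span_zero)
    qed
    have "Y x \<in> ?W" if "x \<in> ?W" for x
      using that by (induction rule: span_induct_alt)
        (auto simp: Y.zero Y.add Y.scale intro: Yh span_zero span_add span_scale)
    moreover have Vh: "V (h j) \<in> ?W" if "j \<in> J" for j
    proof -
      have "j \<le> N" using J(1) that by auto
      then show ?thesis using that by (simp add: eig span_scale span_base)
    qed
    have "V x \<in> ?W" if "x \<in> ?W" for x
      using that by (induction rule: span_induct_alt)
        (auto simp: V.zero V.add V.scale intro: Vh span_zero span_add span_scale)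
    moreover have "h k \<in> ?W" "h k \<noteq> 0"
      using J is_basis_nonzero[OF h] by (auto intro: span_base)
    ultimately have "?W = UNIV"
      using irr[of ?W "h k"] by blast
    moreover have "h ` J \<subseteq> h ` {..N} - {h k'}"
      using J h unfolding is_basis_iff by (auto dest: inj_onD)
    then have "?W \<subseteq> span (h ` {..N} - {h k'})"
      by (rule span_mono)
    ultimately have "h k' \<in> span (h ` {..N} - {h k'})"
      by auto
    then show False
      using h J(3) unfolding is_basis_iff dependent_def by blast
  qed
  have "c i (Suc i) \<noteq> 0" if "i < N" for i
  proof
    assume *: "c i (Suc i) = 0"
    show False
    proof (rule no_block[of "{..i}" i "Suc i"])
      fix j k assume "j \<in> {..i}" "k \<le> N" "k \<notin> {..i}"
      then show "c j k = 0"
        using * c0[of k j] that by (cases "j = i \<and> k = Suc i") auto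
    qed (use that in auto)
  qed
  moreover have "c (Suc i) i \<noteq> 0" if "i < N" for i
  proof
    assume *: "c (Suc i) i = 0"
    show False
    proof (rule no_block[of "{Suc i..N}" "Suc i" i])
      fix j k assume "j \<in> {Suc i..N}" "k \<le> N" "k \<notin> {Suc i..N}"
      then show "c j k = 0"
        using * c0[of k j] that by (cases "j = Suc i \<and> k = i") auto
    qed (use that in auto)
  qed
  ultimately show ?thesis
    using tri unfolding irreducible_tridiagonal_def M by auto
qed

end

section \<open>The quadratic relations with \<open>V\<close>\<close>

text \<open>The scalars of the given operators, with \<open>s = \<beta> + \<zeta>\<close>. In \<open>v_lower\<close> the parameter \<open>c\<close> stands for
\<open>N - 1 - 2 \<alpha> - \<beta> - 2 \<zeta>\<close>, which is \<open>N - 1 - 2 \<alpha> + \<beta> - 2 s\<close>.\<close>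

definition z_eig :: "complex \<Rightarrow> nat \<Rightarrow> complex" where
  "z_eig \<alpha> n = of_nat n - \<alpha>"

definition v_eig :: "complex \<Rightarrow> nat \<Rightarrow> complex" where
  "v_eig s n = (of_nat n - s - 1) * (s - of_nat n)"

definition v_lower :: "nat \<Rightarrow> complex \<Rightarrow> nat \<Rightarrow> complex" where
  "v_lower N c n = of_nat n * (of_nat N + 1 - of_nat n) * (of_nat n + c)"

text \<open>The last four hypotheses are the vanishing of the coefficients of the relation on the diagonals where they
can be nonzero: the raising one, where it only involves \<open>q\<close>, the main one, and the first and second
lowering ones, from which the common factors \<open>l\<close> are cancelled.\<close>

lemma tri_relation:
  fixes l q m r :: "nat \<Rightarrow> complex"
  defines "V \<equiv> tri l q (\<lambda>_. 0)" and "Y \<equiv> tri (\<lambda>_. 0) m r"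
  assumes l0: "l 0 = 0"
    and q: "\<And>n. (q (Suc n) - q n)\<^sup>2 + 2 * (q (Suc n) + q n) = 0"
    and diag: "\<And>n. r n * l (Suc n) * (q (Suc n) - q n + 2)
       + l n * r (n - 1) * (q (n - 1) - q n + 2) + 4 * q n * m n = g0 + g1 * q n + g2 * (q n)\<^sup>2"
    and low: "\<And>n. r (Suc n) * l (Suc (Suc n)) - 2 * l (Suc n) * r n + l n * r (n - 1)
       + m (Suc n) * (q n - q (Suc n) + 2) + m n * (q (Suc n) - q n + 2)
       = g1 + g2 * (q n + q (Suc n))"
    and low2: "\<And>n. m (Suc (Suc n)) - 2 * m (Suc n) + m n = g2"
  shows "V (V (Y x)) j - 2 * V (Y (V x)) j + Y (V (V x)) j + 2 * (V (Y x) j + Y (V x) j)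
    = g0 * x j + g1 * V x j + g2 * V (V x) j"
proof -
  have L: "V x j = l (Suc j) * x (Suc j) + q j * x j" for x j
    by (simp add: V_def tri_def split: nat.split)
  have Y0: "Y x 0 = m 0 * x 0" and YS: "Y x (Suc i) = m (Suc i) * x (Suc i) + r i * x i" for x i
    by (simp_all add: Y_def tri_def)
  define dQ dD dL dM where "dQ n = (q (Suc n) - q n)\<^sup>2 + 2 * (q (Suc n) + q n)"
    and "dD n = r n * l (Suc n) * (q (Suc n) - q n + 2)
       + l n * r (n - 1) * (q (n - 1) - q n + 2) + 4 * q n * m n - (g0 + g1 * q n + g2 * (q n)\<^sup>2)"
    and "dL n = r (Suc n) * l (Suc (Suc n)) - 2 * l (Suc n) * r n + l n * r (n - 1)
       + m (Suc n) * (q n - q (Suc n) + 2) + m n * (q (Suc n) - q n + 2)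
       - (g1 + g2 * (q n + q (Suc n)))"
    and "dM n = m (Suc (Suc n)) - 2 * m (Suc n) + m n - g2" for n
  have "V (V (Y x)) j - 2 * V (Y (V x)) j + Y (V (V x)) j + 2 * (V (Y x) j + Y (V x) j)
      - (g0 * x j + g1 * V x j + g2 * V (V x) j)
    = (case j of 0 \<Rightarrow> 0 | Suc i \<Rightarrow> r i * dQ i * x i) + dD j * x j + l (Suc j) * dL j * x (Suc j)
      + l (Suc j) * l (Suc (Suc j)) * dM j * x (Suc (Suc j))"
  proof (cases j)
    case 0
    then show ?thesis
      by (simp add: L Y0 YS l0 dD_def dL_def dM_def power2_eq_square algebra_simps)
  next
    case (Suc i)
    then show ?thesis
      by (simp add: L YS dQ_def dD_def dL_def dM_def power2_eq_square algebra_simps)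
  qed
  moreover have "dQ n = 0" "dD n = 0" "dL n = 0" "dM n = 0" for n
    unfolding dQ_def dD_def dL_def dM_def using q diag low low2 by (simp_all only: diff_self)
  ultimately show ?thesis by (simp split: nat.splits)
qed

text \<open>The constant \<open>g2\<close> is the second difference of the diagonal entries of the operator paired with \<open>V\<close>,
so it is \<open>0\<close> for \<open>Z\<close> and \<open>- 2\<close> for \<open>X\<close>.\<close>

lemma Z_relation:
  fixes N :: nat and \<alpha> \<beta> s c :: complex
  defines "V \<equiv> tri (v_lower N c) (v_eig s) (\<lambda>_. 0)"
    and "Z \<equiv> tri (\<lambda>_. 0) (z_eig \<alpha>) (\<lambda>_. 1)"
  assumes c: "c = of_nat N - 1 - 2 * \<alpha> + \<beta> - 2 * s"
  obtains g0 g1 g2 where "\<And>x j. V (V (Z x)) j - 2 * V (Z (V x)) j + Z (V (V x)) j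
    + 2 * (V (Z x) j + Z (V x) j) = g0 * x j + g1 * V x j + g2 * V (V x) j"
proof -
  define g1 where "g1 = 2 * (s - \<beta>)"
  \<comment> \<open>Read off from the main diagonal at \<open>n = 0\<close>, where the terms with \<open>v_lower N c 0\<close> drop out.\<close>
  define g0 where
    "g0 = 2 * (s + 1) * of_nat N * (1 + c) + (4 * \<alpha> + g1) * s * (s + 1)"
  have "V (V (Z x)) j - 2 * V (Z (V x)) j + Z (V (V x)) j + 2 * (V (Z x) j + Z (V x) j)
    = g0 * x j + g1 * V x j + 0 * V (V x) j" for x j
    unfolding V_def Z_def
  proof (rule tri_relation)
    show "v_lower N c 0 = 0" by (simp add: v_lower_def)
    fix n
    show "(v_eig s (Suc n) - v_eig s n)\<^sup>2 + 2 * (v_eig s (Suc n) + v_eig s n) = 0"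
      by (simp add: v_eig_def power2_eq_square algebra_simps)
    show "z_eig \<alpha> (Suc (Suc n)) - 2 * z_eig \<alpha> (Suc n) + z_eig \<alpha> n = 0"
      by (simp add: z_eig_def)
    show "1 * v_lower N c (Suc (Suc n)) - 2 * v_lower N c (Suc n) * 1 + v_lower N c n * 1
      + z_eig \<alpha> (Suc n) * (v_eig s n - v_eig s (Suc n) + 2) + z_eig \<alpha> n * (v_eig s (Suc n) - v_eig s n + 2)
         = g1 + 0 * (v_eig s n + v_eig s (Suc n))"
      by (simp add: v_lower_def z_eig_def v_eig_def g1_def c algebra_simps)
    show "1 * v_lower N c (Suc n) * (v_eig s (Suc n) - v_eig s n + 2)
         + v_lower N c n * 1 * (v_eig s (n - 1) - v_eig s n + 2) + 4 * v_eig s n * z_eig \<alpha> n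
        = g0 + g1 * v_eig s n + 0 * (v_eig s n)\<^sup>2"
      by (cases n) (simp_all add: v_lower_def z_eig_def v_eig_def g1_def g0_def c algebra_simps)
  qed
  then show thesis by (rule that)
qed

lemma X_relation:
  fixes N :: nat and \<alpha> \<beta> s c :: complex
  defines "V \<equiv> tri (v_lower N c) (v_eig s) (\<lambda>_. 0)"
    and "X \<equiv> tri (\<lambda>_. 0) (\<lambda>n. - (z_eig \<alpha> n)\<^sup>2) (\<lambda>n. \<beta> - of_nat n)"
  assumes c: "c = of_nat N - 1 - 2 * \<alpha> + \<beta> - 2 * s"
  obtains g0 g1 g2 where "\<And>x j. V (V (X x)) j - 2 * V (X (V x)) j + X (V (V x)) j
    + 2 * (V (X x) j + X (V x) j) = g0 * x j + g1 * V x j + g2 * V (V x) j"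
proof -
  \<comment> \<open>\<open>g1\<close> is read off from the first lowering coefficient, \<open>g0\<close> from the main diagonal at \<open>n = 0\<close>.\<close>
  define g1 where "g1 = - 2 * (s + 2 * s\<^sup>2 - 2 * \<beta> * s + \<beta>\<^sup>2 + 2 * \<alpha> * s - 2 * \<alpha> * \<beta> + 2 * \<alpha>\<^sup>2
      - 2 * of_nat N * s + of_nat N * \<beta> - 2 * of_nat N * \<alpha> + (of_nat N)\<^sup>2)"
  define g0 where "g0 = 2 * (s + 1) * of_nat N * (1 + c) * \<beta> + (4 * \<alpha>\<^sup>2 + g1) * s * (s + 1)
      + 2 * (s * (s + 1))\<^sup>2"
  have "V (V (X x)) j - 2 * V (X (V x)) j + X (V (V x)) j + 2 * (V (X x) j + X (V x) j)
    = g0 * x j + g1 * V x j + (- 2) * V (V x) j" for x j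
    unfolding V_def X_def
  proof (rule tri_relation)
    show "v_lower N c 0 = 0" by (simp add: v_lower_def)
    fix n
    show "(v_eig s (Suc n) - v_eig s n)\<^sup>2 + 2 * (v_eig s (Suc n) + v_eig s n) = 0"
      by (simp add: v_eig_def power2_eq_square algebra_simps)
    show "- (z_eig \<alpha> (Suc (Suc n)))\<^sup>2 - 2 * - (z_eig \<alpha> (Suc n))\<^sup>2 + - (z_eig \<alpha> n)\<^sup>2 = -2"
      by (simp add: z_eig_def power2_eq_square algebra_simps)
    show "(\<beta> - of_nat (Suc n)) * v_lower N c (Suc (Suc n)) - 2 * v_lower N c (Suc n) * (\<beta> - of_nat n) + v_lower N c n * (\<beta> - of_nat (n - 1))
      + - (z_eig \<alpha> (Suc n))\<^sup>2 * (v_eig s n - v_eig s (Suc n) + 2) + - (z_eig \<alpha> n)\<^sup>2 * (v_eig s (Suc n) - v_eig s n + 2)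
         = g1 + - 2 * (v_eig s n + v_eig s (Suc n))"
      by (cases n) (simp_all add: v_lower_def z_eig_def v_eig_def g1_def c power2_eq_square algebra_simps)
    show "(\<beta> - of_nat n) * v_lower N c (Suc n) * (v_eig s (Suc n) - v_eig s n + 2)
         + v_lower N c n * (\<beta> - of_nat (n - 1)) * (v_eig s (n - 1) - v_eig s n + 2) + 4 * v_eig s n * - (z_eig \<alpha> n)\<^sup>2
        = g0 + g1 * v_eig s n + - 2 * (v_eig s n)\<^sup>2"
      by (cases n) (simp_all add: v_lower_def z_eig_def v_eig_def g1_def g0_def c power2_eq_square algebra_simps)
  qed
  then show thesis by (rule that)
qed

section \<open>The lower reduced Leonard trio\<close>

text \<open>Of the nondegeneracy conditions, the first three say that the eigenvalues of \<open>Z\<close> and the linear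
factors in the coefficients of \<open>V\<close> below and above the diagonal in the eigenbasis of \<open>Z\<close> are nonzero.
The last one separates the eigenvalues of \<open>V\<close> and excludes the zeros of
\<open>(i + j - 2 s) (i + j - 2 - 2 s)\<close> in the quadratic relation.\<close>

locale reduced_trio = complex_vector_space scale
  for scale :: "complex \<Rightarrow> 'v::ab_group_add \<Rightarrow> 'v" (infixr "*s" 75) +
  fixes N :: nat and \<alpha> \<beta> s c :: complex and k :: "nat \<Rightarrow> 'v" and Z X V Vt :: "'v \<Rightarrow> 'v"
  assumes c: "c = of_nat N - 1 - 2 * \<alpha> + \<beta> - 2 * s"
    and basis: "is_basis N k"
    and Z_k: "band_action N k Z (\<lambda>_. 0) (z_eig \<alpha>) (\<lambda>_. 1)"
    and X_k: "band_action N k X (\<lambda>_. 0) (\<lambda>n. - (z_eig \<alpha> n)\<^sup>2) (\<lambda>n. \<beta> - of_nat n)"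
    and V_k: "band_action N k V (v_lower N c) (v_eig s) (\<lambda>_. 0)"
    and Vt: "Vt = X \<circ> inv_into UNIV Z"
    and z_eig_nonzero: "\<And>n. n \<le> N \<Longrightarrow> z_eig \<alpha> n \<noteq> 0"
    and raise_factor_nonzero: "\<And>n. n < N \<Longrightarrow> of_nat n + 1 - 2 * \<alpha> + \<beta> \<noteq> 0"
    and lower_factor_nonzero: "\<And>n. n < N \<Longrightarrow> of_nat n + 1 + c \<noteq> 0"
    and two_s: "\<And>m. m + 2 \<le> 2 * N \<Longrightarrow> 2 * s \<noteq> of_nat m"
begin

text \<open>Eliminating \<open>\<beta>\<close> instead of \<open>c\<close> keeps \<open>v_lower\<close> short in the polynomial identities below.\<close>

lemma \<beta>_eq: "\<beta> = c - of_nat N + 1 + 2 * \<alpha> + 2 * s"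
  by (simp add: c)

definition x_raise :: "nat \<Rightarrow> complex" where
  "x_raise n = of_nat n + 1 - 2 * \<alpha> + \<beta>"

definition z_vec :: "nat \<Rightarrow> 'v" where
  "z_vec n = comb N k (exp_seq (\<lambda>_. - 1) n)"

lemma basis_z_vec: "is_basis N z_vec"
  using is_basis_exp_seq[OF basis] by (simp add: z_vec_def[abs_def])

text \<open>The weights \<open>- 1\<close> define \<open>exp (- S)\<close>, and \<open>D + S = exp (- S) D exp S\<close>.\<close>

lemma Z_z_vec: "band_action N z_vec Z (\<lambda>_. 0) (z_eig \<alpha>) (\<lambda>_. 0)"
proof -
  have "band_action N z_vec Z (\<lambda>_. 0) (z_eig \<alpha>) (\<lambda>n. 0 * (- 1))"
    unfolding z_vec_def[abs_def]
    by (rule band_action_exp_seq[OF Z_k, where f = "\<lambda>_. 0" and \<rho> = "\<lambda>_. - 1"])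
      (simp_all add: z_eig_def algebra_simps)
  then show ?thesis by simp
qed

lemma X_z_vec: "band_action N z_vec X (\<lambda>_. 0) (\<lambda>n. - (z_eig \<alpha> n)\<^sup>2) x_raise"
proof -
  have "band_action N z_vec X (\<lambda>_. 0) (\<lambda>n. - (z_eig \<alpha> n)\<^sup>2) (\<lambda>n. - x_raise n * (- 1))"
    unfolding z_vec_def[abs_def]
    by (rule band_action_exp_seq[OF X_k, where f = "\<lambda>_. 0" and \<rho> = "\<lambda>n. of_nat n - \<beta>"])
      (simp_all add: z_eig_def x_raise_def power2_eq_square algebra_simps)
  then show ?thesis by simp
qed

definition v_diag :: "nat \<Rightarrow> complex" where
  "v_diag n = v_eig s n - v_lower N c (Suc n) + v_lower N c n"

text \<open>With weights \<open>- 1\<close> the conjugation takes differences of the cubic \<open>v_lower\<close> and of the quadratic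
\<open>v_eig\<close>. Below the first subdiagonal only the constant third difference of the former and second
difference of the latter remain, and they cancel.\<close>

lemma V_z_vec: "band_action N z_vec V (v_lower N c) v_diag (\<lambda>n. - x_raise n)"
proof -
  have "band_action N z_vec V (v_lower N c) v_diag (\<lambda>n. x_raise n * (- 1))"
    unfolding z_vec_def[abs_def] x_raise_def
    by (rule band_action_exp_seq[OF V_k, where f = "\<lambda>n. - v_lower N c n" and \<rho> = "\<lambda>_. 0"])
      (simp_all add: v_eig_def v_lower_def v_diag_def \<beta>_eq algebra_simps)
  then show ?thesis by simp
qed

lemma inj_z_eig: "inj (z_eig \<alpha>)"
  by (simp add: inj_def z_eig_def)

lemma x_raise_nonzero: "n < N \<Longrightarrow> x_raise n \<noteq> 0"
  unfolding x_raise_def by (rule raise_factor_nonzero)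

lemma v_lower_nonzero: "n < N \<Longrightarrow> v_lower N c (Suc n) \<noteq> 0"
proof -
  assume n: "n < N"
  then have "of_nat N \<noteq> (of_nat n :: complex)" by simp
  moreover have "1 + (of_nat n :: complex) \<noteq> 0"
    by (metis of_nat_Suc of_nat_neq_0)
  moreover have "v_lower N c (Suc n) = (1 + of_nat n) * (of_nat N - of_nat n) * (of_nat n + 1 + c)"
    by (simp add: v_lower_def algebra_simps)
  ultimately show ?thesis
    using lower_factor_nonzero[OF n] by simp
qed

lemma Z_comb: "Z (comb N z_vec x) = comb N z_vec (\<lambda>j. z_eig \<alpha> j * x j)"
  unfolding band_action_comb[OF Z_z_vec] by (rule comb_cong) (simp add: tri_def split: nat.split)

lemma linear_ops:
  "Vector_Spaces.linear scale scale Z" "Vector_Spaces.linear scale scale X"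
  "Vector_Spaces.linear scale scale V"
  using Z_k X_k V_k unfolding band_action_def by auto

lemma bij_Z: "bij Z"
proof (rule bijI)
  interpret Z: Vector_Spaces.linear scale scale Z by (rule linear_ops)
  show "inj Z"
    unfolding Z.inj_iff_eq_0
  proof (intro allI impI)
    fix x assume "Z x = 0"
    moreover obtain y where x: "x = comb N z_vec y"
      using comb_surj[OF basis_z_vec] by blast
    ultimately have "y j = 0" if "j \<le> N" for j
      using comb_eq_0D[OF basis_z_vec, of "\<lambda>j. z_eig \<alpha> j * y j" j] z_eig_nonzero that
      by (simp add: Z_comb)
    then show "x = 0" by (simp add: x comb_def)
  qed
  have "\<exists>y. Z y = x" for x
  proof -
    obtain y where x: "x = comb N z_vec y"
      using comb_surj[OF basis_z_vec] by blast
    have "Z (comb N z_vec (\<lambda>j. y j / z_eig \<alpha> j)) = x"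
      unfolding x Z_comb by (rule comb_cong) (simp add: z_eig_nonzero)
    then show ?thesis by blast
  qed
  then show "surj Z" by (metis surj_def)
qed

lemma Vt_Z: "Vt (Z x) = X x"
  using bij_Z by (simp add: Vt bij_is_inj)

lemma linear_Vt: "Vector_Spaces.linear scale scale Vt"
proof -
  interpret Z: Vector_Spaces.linear scale scale Z by (rule linear_ops)
  interpret X: Vector_Spaces.linear scale scale X by (rule linear_ops)
  have ex: "\<exists>x. y = Z x" for y
    using bij_Z by (auto simp: bij_def)
  show ?thesis
  proof unfold_locales
    fix x y
    obtain x' y' where "x = Z x'" "y = Z y'" using ex by blast
    then show "Vt (x + y) = Vt x + Vt y"
      by (simp add: Vt_Z X.add flip: Z.add)
  next
    fix r x
    obtain x' where "x = Z x'" using ex by blast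
    then show "Vt (r *s x) = r *s Vt x"
      by (simp add: Vt_Z X.scale flip: Z.scale)
  qed
qed

definition vt_raise :: "nat \<Rightarrow> complex" where
  "vt_raise n = x_raise n / z_eig \<alpha> n"

text \<open>As \<open>Z\<close> is diagonal here, \<open>Vt\<close> is \<open>X\<close> with the column \<open>n\<close> divided by \<open>z_eig \<alpha> n\<close>.\<close>

lemma Vt_z_vec: "band_action N z_vec Vt (\<lambda>_. 0) (\<lambda>n. - z_eig \<alpha> n) vt_raise"
proof -
  interpret Vt: Vector_Spaces.linear scale scale Vt by (rule linear_Vt)
  have "Vt (z_vec n) = (- z_eig \<alpha> n) *s z_vec n + vt_raise n *s z_vec (Suc n)" if n: "n \<le> N" for n
  proof -
    have Zn: "Z (z_vec n) = z_eig \<alpha> n *s z_vec n"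
      using Z_z_vec n by (simp add: band_action_def)
    have "z_eig \<alpha> n *s Vt (z_vec n) = X (z_vec n)"
      using Vt_Z[of "z_vec n"] by (simp add: Zn Vt.scale)
    also have "\<dots> = z_eig \<alpha> n *s ((- z_eig \<alpha> n) *s z_vec n + vt_raise n *s z_vec (Suc n))"
      using X_z_vec n z_eig_nonzero[OF n]
      by (simp add: band_action_def vt_raise_def scale_right_distrib scale_right_diff_distrib
          power2_eq_square)
    finally show ?thesis
      using z_eig_nonzero[OF n] by (simp only: scale_cancel_left) simp
  qed
  then show ?thesis
    using Z_z_vec linear_Vt by (simp add: band_action_def)
qed

lemma Z_eigenbasis_matrices:
  "diagonal_mat (matrix_wrt scale (map z_vec [0..<Suc N]) Z)"
  "irreducible_lower_bidiagonal (matrix_wrt scale (map z_vec [0..<Suc N]) Vt)"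
  "irreducible_tridiagonal (matrix_wrt scale (map z_vec [0..<Suc N]) V)"
proof -
  have "x_raise n \<noteq> 0" "vt_raise n \<noteq> 0" if "n < N" for n
    using x_raise_nonzero[OF that] z_eig_nonzero[of n] that by (simp_all add: vt_raise_def)
  note nz = this v_lower_nonzero
  show "diagonal_mat (matrix_wrt scale (map z_vec [0..<Suc N]) Z)"
    unfolding matrix_wrt_band_action[OF basis_z_vec Z_z_vec] by (simp add: diagonal_mat_def)
  show "irreducible_lower_bidiagonal (matrix_wrt scale (map z_vec [0..<Suc N]) Vt)"
    unfolding matrix_wrt_band_action[OF basis_z_vec Vt_z_vec] irreducible_lower_bidiagonal_def
      lower_bidiagonal_def using nz by auto
  show "irreducible_tridiagonal (matrix_wrt scale (map z_vec [0..<Suc N]) V)"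
    unfolding matrix_wrt_band_action[OF basis_z_vec V_z_vec] irreducible_tridiagonal_def
      tridiagonal_def using nz by auto
qed

text \<open>In the eigenbasis of \<open>Z\<close> one has \<open>Z = D\<close> and \<open>Vt = - D + T\<close>, with \<open>T\<close> the shift with weights
\<open>vt_raise\<close>; so \<open>exp T\<close> diagonalises \<open>Vt\<close>, and in the new basis \<open>Z\<close> becomes \<open>D + T\<close>.\<close>

definition vt_vec :: "nat \<Rightarrow> 'v" where
  "vt_vec n = comb N z_vec (exp_seq vt_raise n)"

lemma basis_vt_vec: "is_basis N vt_vec"
  using is_basis_exp_seq[OF basis_z_vec] by (simp add: vt_vec_def[abs_def])

lemma Vt_vt_vec: "band_action N vt_vec Vt (\<lambda>_. 0) (\<lambda>n. - z_eig \<alpha> n) (\<lambda>n. 0 * vt_raise n)"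
  unfolding vt_vec_def[abs_def]
  by (rule band_action_exp_seq[OF Vt_z_vec, where f = "\<lambda>_. 0" and \<rho> = "\<lambda>_. 1"])
    (simp_all add: z_eig_def algebra_simps)

lemma Z_vt_vec: "band_action N vt_vec Z (\<lambda>_. 0) (z_eig \<alpha>) (\<lambda>n. 1 * vt_raise n)"
  unfolding vt_vec_def[abs_def]
  by (rule band_action_exp_seq[OF Z_z_vec, where f = "\<lambda>_. 0" and \<rho> = "\<lambda>_. 0"])
    (simp_all add: z_eig_def algebra_simps)

lemma ZV_z_vec: "band_action N z_vec (Z \<circ> V) (\<lambda>n. z_eig \<alpha> (n - 1) * v_lower N c n)
    (\<lambda>n. z_eig \<alpha> n * v_diag n) (\<lambda>n. - z_eig \<alpha> n * z_eig \<alpha> (Suc n) * vt_raise n)"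
proof -
  interpret Z: Vector_Spaces.linear scale scale Z by (rule linear_ops)
  have Zn: "Z (z_vec n) = z_eig \<alpha> n *s z_vec n" if "n \<le> Suc N" for n
    using Z_z_vec that by (cases "n = Suc N") (auto simp: band_action_def Z.zero)
  have "(Z \<circ> V) (z_vec n) = (z_eig \<alpha> (n - 1) * v_lower N c n) *s z_vec (n - 1)
      + (z_eig \<alpha> n * v_diag n) *s z_vec n
      + (- z_eig \<alpha> n * z_eig \<alpha> (Suc n) * vt_raise n) *s z_vec (Suc n)" if n: "n \<le> N" for n
  proof -
    have Vn: "V (z_vec n)
        = v_lower N c n *s z_vec (n - 1) + v_diag n *s z_vec n + (- x_raise n) *s z_vec (Suc n)"
      using V_z_vec n by (simp add: band_action_def)
    show ?thesis
      using n z_eig_nonzero[OF n]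
      by (simp add: Vn Z.add Z.diff Z.neg Z.scale Zn vt_raise_def algebra_simps)
  qed
  moreover have "Vector_Spaces.linear scale scale (Z \<circ> V)"
    by (rule Vector_Spaces.linear_compose) (rule linear_ops)+
  ultimately show ?thesis
    using V_z_vec by (simp add: band_action_def)
qed

text \<open>The weights \<open>vt_raise\<close> have the eigenvalues of \<open>Z\<close> as denominators. In \<open>Z V\<close> these cancel: the product
of a weight with the matching entry above the diagonal is a polynomial, because that entry carries
the same eigenvalue as a factor. So the conjugation is again one of polynomials.\<close>

lemma ZV_vt_vec: "\<exists>l m r. band_action N vt_vec (Z \<circ> V) l m r"
proof -
  define f where "f n = (of_nat n - 2 * \<alpha> + \<beta>) * v_lower N c n" for n
  \<comment> \<open>The new raising coefficient, found from the coefficient identity at \<open>i = 0\<close>, is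
    \<open>- y (y + 1)\<close> times the weight.\<close>
  define y where "y n = of_nat n - s + \<beta> - \<alpha>" for n
  have "band_action N vt_vec (Z \<circ> V) (\<lambda>n. z_eig \<alpha> (n - 1) * v_lower N c n)
     (\<lambda>n. z_eig \<alpha> n * v_diag n + f (Suc n) - f n) (\<lambda>n. - y n * (y n + 1) * vt_raise n)"
    unfolding vt_vec_def[abs_def]
  proof (rule band_action_exp_seq[OF ZV_z_vec, where \<rho> = "\<lambda>n. - z_eig \<alpha> n * z_eig \<alpha> (Suc n)"])
    show "f 0 = 0" by (simp add: f_def v_lower_def)
    show "f (Suc n) = vt_raise n * (z_eig \<alpha> (Suc n - 1) * v_lower N c (Suc n))" if "n \<le> N" for n
      using z_eig_nonzero[OF that] by (simp add: f_def x_raise_def vt_raise_def)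
    show "f (n + i + 2) + (of_nat i + 2) * (z_eig \<alpha> (n + i + 1) * v_diag (n + i + 1))
        + (of_nat i + 1) * (of_nat i + 2) * (- z_eig \<alpha> (n + i) * z_eig \<alpha> (Suc (n + i)))
      = f n + (of_nat i + 2) * (z_eig \<alpha> n * v_diag n + f (Suc n) - f n)
        + (of_nat i + 1) * (of_nat i + 2) * (- y n * (y n + 1))" for n i
      by (simp add: f_def y_def z_eig_def v_diag_def v_lower_def v_eig_def \<beta>_eq algebra_simps)
  qed simp_all
  then show ?thesis by blast
qed

lemma Vt_eigenbasis_matrices:
  "diagonal_mat (matrix_wrt scale (map vt_vec [0..<Suc N]) Vt)"
  "tridiagonal (matrix_wrt scale (map vt_vec [0..<Suc N]) (Z \<circ> V))"
  "irreducible_lower_bidiagonal (matrix_wrt scale (map vt_vec [0..<Suc N]) Z)"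
proof -
  have nz: "vt_raise n \<noteq> 0" if "n < N" for n
    using x_raise_nonzero[OF that] z_eig_nonzero[of n] that by (simp add: vt_raise_def)
  show "diagonal_mat (matrix_wrt scale (map vt_vec [0..<Suc N]) Vt)"
    unfolding matrix_wrt_band_action[OF basis_vt_vec Vt_vt_vec] by (simp add: diagonal_mat_def)
  show "irreducible_lower_bidiagonal (matrix_wrt scale (map vt_vec [0..<Suc N]) Z)"
    unfolding matrix_wrt_band_action[OF basis_vt_vec Z_vt_vec] irreducible_lower_bidiagonal_def
      lower_bidiagonal_def using nz by auto
  obtain l m r where "band_action N vt_vec (Z \<circ> V) l m r"
    using ZV_vt_vec by blast
  from matrix_wrt_band_action[OF basis_vt_vec this]
  show "tridiagonal (matrix_wrt scale (map vt_vec [0..<Suc N]) (Z \<circ> V))"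
    by (simp add: tridiagonal_def del: upt_Suc)
qed

definition v_vec :: "nat \<Rightarrow> 'v" where
  "v_vec n = comb N k (eig_seq (v_lower N c) (v_eig s) n)"

lemma basis_v_vec: "is_basis N v_vec"
  unfolding v_vec_def[abs_def]
  by (rule is_basis_unitriangular[OF basis, where key = "\<lambda>n. n"])
    (auto simp: eig_seq_def split: if_splits)

lemma V_v_vec:
  assumes "n \<le> N"
  shows "V (v_vec n) = v_eig s n *s v_vec n"
proof -
  have "v_eig s i \<noteq> v_eig s n" if "i < n" for i
  proof -
    have "v_eig s i - v_eig s n = (of_nat n - of_nat i) * (of_nat (i + n - 1) - 2 * s)"
      using that by (simp add: v_eig_def of_nat_diff algebra_simps)
    moreover have "2 * s \<noteq> of_nat (i + n - 1)"
      using that assms by (intro two_s) simp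
    ultimately show ?thesis using that by auto
  qed
  then have eig: "tri (v_lower N c) (v_eig s) (\<lambda>_. 0) (eig_seq (v_lower N c) (v_eig s) n) j
      = v_eig s n * eig_seq (v_lower N c) (v_eig s) n j" for j
    by (rule tri_eig_seq)
  then show ?thesis
    unfolding v_vec_def band_action_comb[OF V_k] scale_comb by (intro comb_cong eig)
qed

lemma v_eig_nondegenerate:
  assumes "i \<le> N" "j \<le> N" "i \<noteq> j" "i \<noteq> Suc j" "j \<noteq> Suc i"
  shows "(v_eig s i - v_eig s j)\<^sup>2 + 2 * (v_eig s i + v_eig s j) \<noteq> 0"
proof -
  have 1: "2 * s \<noteq> of_nat (i + j)" and 2: "2 * s \<noteq> of_nat (i + j - 2)"
    by (rule two_s, use assms in presburger)+
  have ij: "i + j \<ge> 2" using assms by auto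
  have "(v_eig s i - v_eig s j)\<^sup>2 + 2 * (v_eig s i + v_eig s j)
    = (of_nat i - of_nat (Suc j)) * (of_nat (Suc i) - of_nat j)
      * (of_nat (i + j) - 2 * s) * (of_nat (i + j - 2) - 2 * s)"
    using ij by (simp add: v_eig_def of_nat_diff power2_eq_square algebra_simps)
  moreover have "of_nat i \<noteq> (of_nat (Suc j) :: complex)" "of_nat (Suc i) \<noteq> (of_nat j :: complex)"
    unfolding of_nat_eq_iff using assms by auto
  ultimately show ?thesis using 1 2 by auto
qed

lemma V_eigenbasis_matrices:
  "diagonal_mat (matrix_wrt scale (map v_vec [0..<Suc N]) V)"
  "tridiagonal (matrix_wrt scale (map v_vec [0..<Suc N]) (Vt \<circ> Z))"
  "irreducible_tridiagonal (matrix_wrt scale (map v_vec [0..<Suc N]) Z)"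
proof -
  have "V (v_vec n) = comb N v_vec (\<lambda>j. if j = n then v_eig s n else 0)" if "n \<le> N" for n
    using that by (simp add: V_v_vec comb_single)
  from matrix_wrt_comb[where A = V and c = "\<lambda>n j. if j = n then v_eig s n else 0", OF basis_v_vec this]
  show "diagonal_mat (matrix_wrt scale (map v_vec [0..<Suc N]) V)"
    by (simp add: diagonal_mat_def del: upt_Suc)
  note to_comb = band_action_comb[OF V_k] band_action_comb[OF Z_k] band_action_comb[OF X_k]
    scale_comb comb_add comb_diff
  let ?V = "tri (v_lower N c) (v_eig s) (\<lambda>_. 0)"
  let ?Z = "tri (\<lambda>_. 0) (z_eig \<alpha>) (\<lambda>_. 1)"
  let ?X = "tri (\<lambda>_. 0) (\<lambda>n. - (z_eig \<alpha> n)\<^sup>2) (\<lambda>n. \<beta> - of_nat n)"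
  obtain g0 g1 g2 where seqZ: "\<And>x j. ?V (?V (?Z x)) j - 2 * ?V (?Z (?V x)) j + ?Z (?V (?V x)) j
      + 2 * (?V (?Z x) j + ?Z (?V x) j) = g0 * x j + g1 * ?V x j + g2 * ?V (?V x) j"
    using Z_relation[OF c] by metis
  have relZ: "V (V (Z x)) - 2 *s V (Z (V x)) + Z (V (V x)) + 2 *s (V (Z x) + Z (V x))
      = g0 *s x + g1 *s V x + g2 *s V (V x)" for x
  proof -
    obtain y where x: "x = comb N k y" using comb_surj[OF basis] by blast
    show ?thesis
      unfolding x to_comb by (intro comb_cong seqZ)
  qed
  obtain h0 h1 h2 where seqX: "\<And>x j. ?V (?V (?X x)) j - 2 * ?V (?X (?V x)) j + ?X (?V (?V x)) j
      + 2 * (?V (?X x) j + ?X (?V x) j) = h0 * x j + h1 * ?V x j + h2 * ?V (?V x) j"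
    using X_relation[OF c] by metis
  have relX: "V (V (X x)) - 2 *s V (X (V x)) + X (V (V x)) + 2 *s (V (X x) + X (V x))
      = h0 *s x + h1 *s V x + h2 *s V (V x)" for x
  proof -
    obtain y where x: "x = comb N k y" using comb_surj[OF basis] by blast
    show ?thesis
      unfolding x to_comb by (intro comb_cong seqX)
  qed
  have "tridiagonal (matrix_wrt scale (map v_vec [0..<Suc N]) X)"
    by (rule tridiagonal_of_relation[OF basis_v_vec linear_ops(3,2) V_v_vec relX v_eig_nondegenerate])
  moreover have "Vt \<circ> Z = X"
    by (simp add: fun_eq_iff Vt_Z)
  ultimately show "tridiagonal (matrix_wrt scale (map v_vec [0..<Suc N]) (Vt \<circ> Z))"
    by (simp only:)
  have triZ: "tridiagonal (matrix_wrt scale (map v_vec [0..<Suc N]) Z)"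
    by (rule tridiagonal_of_relation[OF basis_v_vec linear_ops(3,1) V_v_vec relZ v_eig_nondegenerate])
  have "- x_raise n \<noteq> 0" if "n < N" for n
    using x_raise_nonzero[OF that] by simp
  note inv = invariant_subspace_eq_UNIV[OF basis_z_vec Z_z_vec inj_z_eig V_z_vec v_lower_nonzero this]
  show "irreducible_tridiagonal (matrix_wrt scale (map v_vec [0..<Suc N]) Z)"
    by (rule irreducible_tridiagonal_of_no_invariant[OF basis_v_vec linear_ops(3,1) V_v_vec triZ inv])
qed

theorem leonard_trio: "lower_reduced_leonard_trio scale V Vt Z"
  unfolding lower_reduced_leonard_trio_def
  using linear_ops linear_Vt basis_v_vec V_eigenbasis_matrices basis_vt_vec Vt_eigenbasis_matrices
    basis_z_vec Z_eigenbasis_matrices by blast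

end

theorem proposition3:
  fixes scale :: "complex \<Rightarrow> 'v::ab_group_add \<Rightarrow> 'v"
    and N :: nat
    and \<alpha> \<beta> \<zeta> :: complex
    and ket :: "int \<Rightarrow> 'v"
    and Z X V Vt :: "'v \<Rightarrow> 'v"
  assumes "vector_space scale"
    and "N > 0"
    and "ordered_basis scale (map ket [0..int N])"
    and "ket (- 1) = 0" and "ket (int N + 1) = 0"
    and "Vector_Spaces.linear scale scale Z"
    and "Vector_Spaces.linear scale scale X"
    and "Vector_Spaces.linear scale scale V"
    and "\<And>n. n \<in> {0..int N} \<Longrightarrow>
      Z (ket n) = scale (of_int n - \<alpha>) (ket n) + ket (n + 1)"
    and "\<And>n. n \<in> {0..int N} \<Longrightarrow>
      X (ket n) = - scale ((of_int n - \<alpha>)\<^sup>2) (ket n) - scale (of_int n - \<beta>) (ket (n + 1))"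
    and "\<And>n. n \<in> {0..int N} \<Longrightarrow>
      V (ket n) = scale ((of_int n - \<beta> - \<zeta> - 1) * (\<beta> + \<zeta> - of_int n)) (ket n)
        + scale (of_int n * (of_nat N + 1 - of_int n)
                 * (of_int n - 1 - 2 * \<alpha> - \<beta> - 2 * \<zeta> + of_nat N)) (ket (n - 1))"
    and "Vt = X \<circ> inv_into UNIV Z"
    \<comment> \<open>non-degeneracy of the parameters; the first condition says that \<open>Z\<close> is invertible\<close>
    and "\<alpha> \<notin> of_int ` {0..int N}"
    and "2 * \<alpha> - \<beta> \<notin> of_int ` {1..int N}"
    and "2 * \<alpha> + \<beta> + 2 * \<zeta> \<notin> of_int ` {int N..2 * int N - 1}"
    and "2 * (\<beta> + \<zeta>) \<notin> of_int ` {0..2 * int N - 2}"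
  shows "lower_reduced_leonard_trio scale V Vt Z"
proof -
  interpret complex_vector_space scale
    using assms(1) by (rule complex_vector_space.intro)
  define k where "k n = ket (int n)" for n
  let ?s = "\<beta> + \<zeta>" and ?c = "of_nat N - 1 - 2 * \<alpha> - \<beta> - 2 * \<zeta>"
  have k: "map k [0..<Suc N] = map ket [0..int N]"
  proof (rule nth_equalityI)
    fix i assume "i < length (map k [0..<Suc N])"
    then have "i \<le> N" by simp
    then show "map k [0..<Suc N] ! i = map ket [0..int N] ! i"
      by (simp add: k_def nth_upto del: upt_Suc)
  qed (simp del: upt_Suc)
  have kN: "k (Suc N) = 0"
    using assms(5) by (simp add: k_def add.commute)
  have ket: "ket (int n + 1) = k (Suc n)" for n
    by (simp add: k_def add.commute)
  interpret reduced_trio scale N \<alpha> \<beta> ?s ?c k Z X V Vt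
  proof unfold_locales
    show "?c = of_nat N - 1 - 2 * \<alpha> + \<beta> - 2 * ?s"
      by simp
    show "is_basis N k"
      using assms(3) by (simp only: k)
    show "band_action N k Z (\<lambda>_. 0) (z_eig \<alpha>) (\<lambda>_. 1)"
      unfolding band_action_def using assms(6) kN assms(9)[of "int n" for n]
      by (simp add: z_eig_def ket flip: k_def)
    show "band_action N k X (\<lambda>_. 0) (\<lambda>n. - (z_eig \<alpha> n)\<^sup>2) (\<lambda>n. \<beta> - of_nat n)"
      unfolding band_action_def using assms(7) kN assms(10)[of "int n" for n]
      by (simp add: z_eig_def ket scale_left_diff_distrib flip: k_def)
    have "V (k n) = scale (v_lower N ?c n) (k (n - 1)) + scale (v_eig ?s n) (k n)" if "n \<le> N" for n
    proof -
      have "scale (v_lower N ?c n) (k (n - 1)) = scale (v_lower N ?c n) (ket (int n - 1))"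
        by (cases n) (simp_all add: v_lower_def k_def)
      moreover have "v_eig ?s n = (of_int (int n) - \<beta> - \<zeta> - 1) * (\<beta> + \<zeta> - of_int (int n))"
        by (simp add: v_eig_def algebra_simps)
      moreover have "v_lower N ?c n = of_int (int n) * (of_nat N + 1 - of_int (int n))
          * (of_int (int n) - 1 - 2 * \<alpha> - \<beta> - 2 * \<zeta> + of_nat N)"
        by (simp add: v_lower_def algebra_simps)
      moreover have "int n \<in> {0..int N}"
        using that by simp
      ultimately show ?thesis
        using assms(11)[of "int n"] by (simp only: k_def add.commute)
    qed
    then show "band_action N k V (v_lower N ?c) (v_eig ?s) (\<lambda>_. 0)"
      unfolding band_action_def using assms(8) kN by (simp add: v_lower_def)
    show "Vt = X \<circ> inv_into UNIV Z" by fact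
    fix n :: nat
    show "z_eig \<alpha> n \<noteq> 0" if "n \<le> N"
      using assms(13) that imageI[of "int n" "{0..int N}" "of_int :: int \<Rightarrow> complex"]
      by (auto simp: z_eig_def)
    show "of_nat n + 1 - 2 * \<alpha> + \<beta> \<noteq> 0" if "n < N"
    proof
      assume "of_nat n + 1 - 2 * \<alpha> + \<beta> = 0"
      then have "2 * \<alpha> - \<beta> = of_int (int n + 1)"
        by (simp add: algebra_simps)
      moreover have "int n + 1 \<in> {1..int N}"
        using that by simp
      ultimately show False
        using assms(14) by blast
    qed
    show "of_nat n + 1 + ?c \<noteq> 0" if "n < N"
    proof
      assume "of_nat n + 1 + ?c = 0"
      then have "2 * \<alpha> + \<beta> + 2 * \<zeta> = of_int (int N + int n)"
        by (simp add: algebra_simps)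
      moreover have "int N + int n \<in> {int N..2 * int N - 1}"
        using that by simp
      ultimately show False
        using assms(15) by blast
    qed
    show "2 * ?s \<noteq> of_nat n" if "n + 2 \<le> 2 * N"
      using assms(16) that imageI[of "int n" "{0..2 * int N - 2}" "of_int :: int \<Rightarrow> complex"]
      by auto
  qed
  show ?thesis by (rule leonard_trio)
qed
end
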